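(* Let $X$ be a real Banach space and let $Y$ be a strict ideal of $X$. If $Y^*$ has the $w^*$-ball dentable property, then $X^*$ has the $w^*$-ball dentable property.
   Context: $B_X$ denotes the closed unit ball of a Banach space $X$, and $X^*$ its dual. For a bounded set $C \subseteq X^*$, $x \in X$ with $\|x\| = 1$ and $\alpha > 0$, the set $\{x^* \in C : x^*(x) > \sup_{c^* \in C} c^*(x) - \alpha\}$ is called a (open) $w^*$-slice of $C$. The dual space $X^*$ is said to have the $w^*$-ball dentable property ($w^*$-BDP) if $B_{X^*}$ has $w^*$-slices (determined by elements of $X$) of arbitrarily small diameter, i.e. for every $\varepsilon > 0$ there is a $w^*$-slice $S$ of $B_{X^*}$ with $\operatorname{diam}(S) < \varepsilon$. For $Y^*$ the $w^*$-slices are determined by elements of $Y$. A closed subspace $Y \subseteq X$ is an ideal if there is a linear projection $P : X^* \to X^*$ with $\|P\| = 1$ and $\ker(P) = Y^\perp = \{x^* \in X^* : x^*|_Y = 0\}$. It is a strict ideal if, for such a projection $P$, one also has that $B_{P(X^* )}$ is $w^*$-dense in $B_{X^*}$ (equivalently, $B_{P(X^* )}$ is a norming set for $X$: $\|x\| = \sup\{|x^*(x)| : x^* \in B_{P(X^* )}\}$ for all $x \in X$). *)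

theory Defs
  imports "HOL-Analysis.Analysis"
begin

text \<open>The dual of a normed space \<open>'a\<close> is the type \<open>'a \<Rightarrow>\<^sub>L real\<close>. The dual of a subspace \<open>Y\<close>, which is
  not a type, is the set of bounded linear functionals on \<open>Y\<close>, made extensional so that two of them
  are equal iff they agree on \<open>Y\<close>.\<close>

definition dual_on :: "'a::real_normed_vector set \<Rightarrow> ('a \<Rightarrow> real) set" where
  "dual_on Y = {f \<in> extensional Y.
     (\<forall>x\<in>Y. \<forall>y\<in>Y. f (x + y) = f x + f y) \<and>
     (\<forall>c. \<forall>y\<in>Y. f (c *\<^sub>R y) = c * f y) \<and>
     (\<exists>K. \<forall>y\<in>Y. \<bar>f y\<bar> \<le> K * norm y)}"

definition norm_on :: "'a::real_normed_vector set \<Rightarrow> ('a \<Rightarrow> real) \<Rightarrow> real" where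
  "norm_on Y f = (SUP y\<in>Y \<inter> cball 0 1. \<bar>f y\<bar>)"

definition dual_ball_on :: "'a::real_normed_vector set \<Rightarrow> ('a \<Rightarrow> real) set" where
  "dual_ball_on Y = {f \<in> dual_on Y. norm_on Y f \<le> 1}"

text \<open>The analogue of \<^const>\<open>diameter\<close> for the dual norm on \<open>dual_on Y\<close>.\<close>

definition diameter_on :: "'a::real_normed_vector set \<Rightarrow> ('a \<Rightarrow> real) set \<Rightarrow> real" where
  "diameter_on Y S =
     (if S = {} then 0 else SUP (f, g)\<in>S \<times> S. norm_on Y (\<lambda>y. f y - g y))"

text \<open>The evaluation map \<open>ev\<close> is \<^const>\<open>blinfun_apply\<close> for the dual of a type and the identity for
  \<open>dual_on Y\<close>.\<close>

definition w_star_slice :: "('f \<Rightarrow> 'a \<Rightarrow> real) \<Rightarrow> 'f set \<Rightarrow> 'a \<Rightarrow> real \<Rightarrow> 'f set" where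
  "w_star_slice ev C x \<alpha> = {f \<in> C. ev f x > (SUP c\<in>C. ev c x) - \<alpha>}"

definition w_star_BDP :: "'a::real_normed_vector itself \<Rightarrow> bool" where
  "w_star_BDP (_ :: 'a itself) \<longleftrightarrow>
     (\<forall>\<epsilon>>0. \<exists>x::'a. \<exists>\<alpha>>0. norm x = 1 \<and>
        diameter (w_star_slice blinfun_apply (cball 0 1 :: ('a \<Rightarrow>\<^sub>L real) set) x \<alpha>) < \<epsilon>)"

definition w_star_BDP_on :: "'a::real_normed_vector set \<Rightarrow> bool" where
  "w_star_BDP_on Y \<longleftrightarrow>
     (\<forall>\<epsilon>>0. \<exists>y\<in>Y. \<exists>\<alpha>>0. norm y = 1 \<and>
        diameter_on Y (w_star_slice (\<lambda>f. f) (dual_ball_on Y) y \<alpha>) < \<epsilon>)"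

definition annihilator :: "'a::real_normed_vector set \<Rightarrow> ('a \<Rightarrow>\<^sub>L real) set" where
  "annihilator Y = {f. \<forall>y\<in>Y. blinfun_apply f y = 0}"

definition ideal_projection ::
  "'a::real_normed_vector set \<Rightarrow> (('a \<Rightarrow>\<^sub>L real) \<Rightarrow>\<^sub>L ('a \<Rightarrow>\<^sub>L real)) \<Rightarrow> bool" where
  "ideal_projection Y P \<longleftrightarrow>
     P o\<^sub>L P = P \<and> norm P = 1 \<and> {f. blinfun_apply P f = 0} = annihilator Y"

text \<open>On real-valued functionals the strong operator topology is the topology of pointwise
  convergence, i.e. the weak-* topology.\<close>

definition strict_ideal :: "'a::real_normed_vector set \<Rightarrow> bool" where
  "strict_ideal Y \<longleftrightarrow> subspace Y \<and> closed Y \<and>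
     (\<exists>P. ideal_projection Y P \<and>
        cball 0 1 \<subseteq> strong_operator_topology closure_of (cball 0 1 \<inter> range (blinfun_apply P)))"

text \<open>The two renderings of the dual space, and hence of the dentability property, agree on the
  whole space.\<close>

lemma dual_on_UNIV: "dual_on UNIV = range (blinfun_apply :: ('a::real_normed_vector \<Rightarrow>\<^sub>L real) \<Rightarrow> _)"
proof (intro equalityI subsetI)
  fix f :: "'a \<Rightarrow> real" assume "f \<in> dual_on UNIV"
  then obtain K where "\<And>x y. f (x + y) = f x + f y" "\<And>c y. f (c *\<^sub>R y) = c * f y"
    "\<And>y. \<bar>f y\<bar> \<le> K * norm y"
    unfolding dual_on_def by auto
  then have "bounded_linear f"
    by (intro bounded_linear_intro[of f K]) (auto simp: mult.commute)
  then show "f \<in> range blinfun_apply"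
    by (metis bounded_linear_Blinfun_apply rangeI)
next
  fix f :: "'a \<Rightarrow> real" assume "f \<in> range blinfun_apply"
  then obtain g :: "'a \<Rightarrow>\<^sub>L real" where f: "f = blinfun_apply g" by auto
  have "\<forall>y. \<bar>blinfun_apply g y\<bar> \<le> norm g * norm y"
    using norm_blinfun[of g] by simp
  then show "f \<in> dual_on UNIV"
    unfolding f dual_on_def by (auto simp: blinfun.add_right blinfun.scaleR_right)
qed

lemma norm_on_UNIV: "norm_on UNIV (blinfun_apply f) = norm (f :: 'a::real_normed_vector \<Rightarrow>\<^sub>L real)"
proof (rule antisym)
  have le: "\<bar>blinfun_apply f y\<bar> \<le> norm f" if "norm y \<le> 1" for y
    using norm_blinfun[of f y] mult_left_le[OF that norm_ge_zero[of f]] by simp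
  have bdd: "bdd_above ((\<lambda>y. \<bar>blinfun_apply f y\<bar>) ` (UNIV \<inter> cball 0 1))"
    using le by (auto intro!: bdd_aboveI[of _ "norm f"])
  show "norm_on UNIV (blinfun_apply f) \<le> norm f"
    unfolding norm_on_def using le by (intro cSUP_least) (auto intro: exI[of _ 0])
  have up: "\<bar>blinfun_apply f y\<bar> \<le> norm_on UNIV (blinfun_apply f)" if "norm y \<le> 1" for y
    unfolding norm_on_def using that by (intro cSUP_upper bdd) auto
  have "0 \<le> norm_on UNIV (blinfun_apply f)"
    using up[of 0] by simp
  moreover have "norm (blinfun_apply f x) \<le> norm_on UNIV (blinfun_apply f) * norm x" for x
  proof (cases "x = 0")
    case False
    then show ?thesis
      using up[of "x /\<^sub>R norm x"]
      by (simp add: blinfun.scaleR_right abs_mult field_simps)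
  qed simp
  ultimately show "norm f \<le> norm_on UNIV (blinfun_apply f)"
    by (rule norm_blinfun_bound)
qed

lemma dual_ball_on_UNIV:
  "dual_ball_on UNIV = blinfun_apply ` (cball 0 1 :: ('a::real_normed_vector \<Rightarrow>\<^sub>L real) set)"
  unfolding dual_ball_on_def dual_on_UNIV by (auto simp: norm_on_UNIV)

lemma diameter_on_UNIV:
  "diameter_on UNIV (blinfun_apply ` S) = diameter (S :: ('a::real_normed_vector \<Rightarrow>\<^sub>L real) set)"
proof -
  have "norm_on UNIV (\<lambda>y. blinfun_apply f y - blinfun_apply g y) = dist f g"
    for f g :: "'a \<Rightarrow>\<^sub>L real"
    using norm_on_UNIV[of "f - g"] by (simp add: dist_norm minus_blinfun.rep_eq)
  then have "(\<lambda>(f, g). norm_on UNIV (\<lambda>y. f y - g y)) ` (blinfun_apply ` S \<times> blinfun_apply ` S) =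
    (\<lambda>(f, g). dist f g) ` (S \<times> S)"
    by (force simp: image_iff)
  then show ?thesis
    unfolding diameter_on_def diameter_def by simp
qed

lemma w_star_slice_UNIV:
  "w_star_slice (\<lambda>f. f) (blinfun_apply ` C) x \<alpha> = blinfun_apply ` w_star_slice blinfun_apply C x \<alpha>"
  unfolding w_star_slice_def by (auto simp: image_image)

lemma w_star_BDP_on_UNIV: "w_star_BDP_on (UNIV :: 'a set) \<longleftrightarrow> w_star_BDP TYPE('a::real_normed_vector)"
  unfolding w_star_BDP_on_def w_star_BDP_def
  by (simp add: dual_ball_on_UNIV w_star_slice_UNIV diameter_on_UNIV)

end

theory Submission
  imports Defs
begin

text \<open>By the Hahn--Banach theorem restriction to \<open>Y\<close> maps \<open>B\<^bsub>X\<^sup>*\<^esub>\<close> onto \<open>B\<^bsub>Y\<^sup>*\<^esub>\<close>, so for \<open>y \<in> Y\<close> the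
  slices of the two balls given by \<open>y\<close> and \<open>\<alpha>\<close> are cut off at the same height. On the range of an
  ideal projection restriction to \<open>Y\<close> is isometric, hence two functionals in the range that belong
  to the slice of \<open>B\<^bsub>X\<^sup>*\<^esub>\<close> are no further apart than the diameter \<open>d\<close> of the slice of \<open>B\<^bsub>Y\<^sup>*\<^esub>\<close>. As the
  slice is weak-* open in the ball and the dual norm is weak-* lower semicontinuous, density of the
  range extends the bound \<open>d\<close> to the whole slice.\<close>

section \<open>The Hahn--Banach theorem\<close>

text \<open>Partial linear functionals are represented by their graphs, which are subspaces of
  \<open>'a \<times> real\<close>; being single-valued follows from domination by \<open>p\<close>.\<close>

lemma dominated_graph_extension:
  fixes M :: "('a::real_vector \<times> real) set"
  assumes p_add: "\<And>x y. p (x + y) \<le> p x + p y"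
    and p_scale: "\<And>c x. 0 \<le> c \<Longrightarrow> p (c *\<^sub>R x) = c * p x"
    and M: "subspace M" and dom: "\<And>u a. (u, a) \<in> M \<Longrightarrow> a \<le> p u"
  shows "\<exists>c. \<forall>(z, d) \<in> span (insert (x, c) M). d \<le> p z"
proof -
  \<comment> \<open>The value at \<open>x\<close> of a dominated extension must lie above all
    numbers \<open>a - p (u - x)\<close> and below all numbers \<open>p (v + x) - b\<close>; the
    supremum of the former is one such choice.\<close>
  define c where "c = (SUP (u, a)\<in>M. a - p (u - x))"
  \<comment> \<open>Every lower bound is at most every upper bound, because u + v = (u - x) + (v +
    x) and \<open>p\<close> is subadditive.\<close>
  have sep: "a - p (u - x) \<le> p (v + x) - b" if "(u, a) \<in> M" "(v, b) \<in> M" for u a v b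
  proof -
    have "a + b \<le> p (u + v)"
      using subspace_add[OF M that] dom by simp
    also have "\<dots> \<le> p (u - x) + p (v + x)"
      using p_add[of "u - x" "v + x"] by (simp add: algebra_simps)
    finally show ?thesis by simp
  qed
  have zero: "(0, 0) \<in> M"
    using subspace_0[OF M] by (simp add: zero_prod_def)
  have lower: "a - p (u - x) \<le> c" if "(u, a) \<in> M" for u a
  proof -
    have "bdd_above ((\<lambda>(u, a). a - p (u - x)) ` M)"
      using sep[OF _ zero] by (intro bdd_aboveI[of _ "p (0 + x) - 0"]) auto
    from cSUP_upper[OF that this] show ?thesis
      by (simp add: c_def)
  qed
  have upper: "c \<le> p (v + x) - b" if "(v, b) \<in> M" for v b
    unfolding c_def using zero sep[OF _ that] by (intro cSUP_least) auto
  have "d \<le> p z" if zd: "(z, d) \<in> span (insert (x, c) M)" for z d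
  proof -
    obtain k where k: "(z - k *\<^sub>R x, d - k * c) \<in> M"
      using zd unfolding span_breakdown_eq span_eq_iff[THEN iffD2, OF M] by auto
    \<comment> \<open>After scaling by the positive number 1/k or 1/(-k), the element of
      \<open>M\<close> has first component z/k - x or z/(-k) + x. These are the shapes to which
      \<open>upper\<close> and \<open>lower\<close> apply, respectively, and homogeneity of
      \<open>p\<close> undoes the scaling.\<close>
    consider "k = 0" | "k > 0" | "k < 0" by linarith
    then show ?thesis
    proof cases
      case 1
      then show ?thesis using k dom by simp
    next
      case 2
      have "((1/k) *\<^sub>R (z - k *\<^sub>R x), (1/k) * (d - k * c)) \<in> M"
        using subspace_scale[OF M k, of "1/k"] by simp
      from upper[OF this] have "c \<le> p ((1/k) *\<^sub>R z) - (1/k) * (d - k * c)"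
        using 2 by (simp add: scaleR_diff_right)
      then show ?thesis
        using 2 by (simp add: p_scale field_simps)
    next
      case 3
      have "((1/(-k)) *\<^sub>R (z - k *\<^sub>R x), (1/(-k)) * (d - k * c)) \<in> M"
        using subspace_scale[OF M k, of "1/(-k)"] by simp
      from lower[OF this] have "(1/(-k)) * (d - k * c) - p ((1/(-k)) *\<^sub>R z) \<le> c"
        using 3 by (simp add: scaleR_diff_right)
      then have "(1/(-k)) * (d - k * c) - (1/(-k)) * p z \<le> c"
        using 3 p_scale[of "1/(-k)" z] by simp
      then show ?thesis
        using 3 by (simp add: field_simps)
    qed
  qed
  then show ?thesis by blast
qed

text \<open>Zorn's lemma is applied to the dominated subspaces containing the graph of
  \<open>f\<close>. A maximal one has a point over every \<open>x\<close>, since otherwise the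
  one-dimensional extension would enlarge it, so it is the graph of the desired functional.\<close>

theorem hahn_banach_sublinear:
  fixes p :: "'a::real_vector \<Rightarrow> real"
  assumes p_add: "\<And>x y. p (x + y) \<le> p x + p y"
    and p_scale: "\<And>c x. 0 \<le> c \<Longrightarrow> p (c *\<^sub>R x) = c * p x"
    and V: "subspace V"
    and f_add: "\<And>x y. x \<in> V \<Longrightarrow> y \<in> V \<Longrightarrow> f (x + y) = f x + f y"
    and f_scale: "\<And>c x. x \<in> V \<Longrightarrow> f (c *\<^sub>R x) = c * f x"
    and f_le: "\<And>x. x \<in> V \<Longrightarrow> f x \<le> p x"
  shows "\<exists>g. linear g \<and> (\<forall>x\<in>V. g x = f x) \<and> (\<forall>x. g x \<le> p x)"
proof -
  define G where "G = (\<lambda>x. (x, f x)) ` V"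
  define \<A> where "\<A> = {M. subspace M \<and> G \<subseteq> M \<and> (\<forall>(u, a)\<in>M. a \<le> p u)}"
  have "subspace G"
    unfolding subspace_def
  proof (intro conjI ballI allI)
    show "0 \<in> G"
      using subspace_0[OF V] f_scale[of 0 0] by (force simp: G_def zero_prod_def)
  qed (auto simp: G_def image_iff f_add f_scale subspace_add[OF V] subspace_scale[OF V])
  then have "G \<in> \<A>"
    using f_le by (auto simp: \<A>_def G_def)
  have "\<exists>M\<in>\<A>. \<forall>X\<in>\<A>. M \<subseteq> X \<longrightarrow> X = M"
  proof (rule subset_Zorn_nonempty)
    show "\<A> \<noteq> {}" using \<open>G \<in> \<A>\<close> by auto
  next
    fix \<C> assume ne: "\<C> \<noteq> {}" and ch: "subset.chain \<A> \<C>"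
    have C: "subspace M" "G \<subseteq> M" "\<And>u a. (u, a) \<in> M \<Longrightarrow> a \<le> p u" if "M \<in> \<C>" for M
      using ch that by (auto simp: subset.chain_def \<A>_def)
    have "subspace (\<Union>\<C>)"
      unfolding subspace_def
    proof (intro conjI ballI allI)
      show "0 \<in> \<Union>\<C>" using ne C(1) subspace_0 by blast
    next
      fix v w assume "v \<in> \<Union>\<C>" "w \<in> \<Union>\<C>"
      then obtain M N where MN: "M \<in> \<C>" "N \<in> \<C>" "v \<in> M" "w \<in> N" by auto
      \<comment> \<open>Sums stay in the union because two members of a chain are comparable, so
        both summands lie in the larger one.\<close>
      then have "M \<subseteq> N \<or> N \<subseteq> M"
        using ch by (auto simp: subset_chain_def)
      with MN show "v + w \<in> \<Union>\<C>"
        by (meson C(1) UnionI subsetD subspace_add)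
    next
      fix c v assume "v \<in> \<Union>\<C>"
      then show "c *\<^sub>R v \<in> \<Union>\<C>"
        using C(1) subspace_scale by blast
    qed
    moreover have "G \<subseteq> \<Union>\<C>" using ne C(2) by blast
    ultimately show "\<Union>\<C> \<in> \<A>"
      using C(3) by (auto simp: \<A>_def)
  qed
  then obtain M where "M \<in> \<A>" and max: "\<And>X. X \<in> \<A> \<Longrightarrow> M \<subseteq> X \<Longrightarrow> X = M" by blast
  then have M: "subspace M" "G \<subseteq> M" and dom: "\<And>u a. (u, a) \<in> M \<Longrightarrow> a \<le> p u"
    by (auto simp: \<A>_def)
  have total: "\<exists>a. (x, a) \<in> M" for x
  proof -
    obtain c where c: "\<forall>(z, d) \<in> span (insert (x, c) M). d \<le> p z"
      using dominated_graph_extension[OF p_add p_scale M(1) dom] by blast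
    have sub: "insert (x, c) M \<subseteq> span (insert (x, c) M)"
      by (rule span_superset)
    with M(2) have "G \<subseteq> span (insert (x, c) M)" by blast
    with c have "span (insert (x, c) M) \<in> \<A>"
      unfolding \<A>_def by (simp add: subspace_span)
    with max sub have "span (insert (x, c) M) = M" by blast
    with sub show ?thesis by blast
  qed
  have p0: "p 0 = 0"
    using p_scale[of 0 0] by simp
  \<comment> \<open>Both (0, a - b) and (0, b - a) lie in \<open>M\<close>, so domination bounds
    both differences by p 0 = 0.\<close>
  have unique: "a = b" if "(x, a) \<in> M" "(x, b) \<in> M" for x a b
    using dom[of 0 "a - b"] dom[of 0 "b - a"] p0
      subspace_diff[OF M(1) that] subspace_diff[OF M(1) that(2,1)] by simp
  obtain g where g: "\<And>x. (x, g x) \<in> M"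
    using total by metis
  have "linear g"
  proof (rule linearI)
    show "g (x + y) = g x + g y" for x y
      using unique[OF g] subspace_add[OF M(1) g[of x] g[of y]] by simp
    show "g (c *\<^sub>R x) = c *\<^sub>R g x" for c x
      using unique[OF g] subspace_scale[OF M(1) g[of x], of c] by simp
  qed
  moreover have "g x = f x" if "x \<in> V" for x
    using unique[OF g] M(2) that by (auto simp: G_def)
  ultimately show ?thesis
    using dom[OF g] by blast
qed

corollary hahn_banach_norm:
  fixes f :: "'a::real_normed_vector \<Rightarrow> real"
  assumes V: "subspace V"
    and f_add: "\<And>x y. x \<in> V \<Longrightarrow> y \<in> V \<Longrightarrow> f (x + y) = f x + f y"
    and f_scale: "\<And>c x. x \<in> V \<Longrightarrow> f (c *\<^sub>R x) = c * f x"
    and f_le: "\<And>x. x \<in> V \<Longrightarrow> f x \<le> K * norm x" and K: "0 \<le> K"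
  shows "\<exists>g :: 'a \<Rightarrow>\<^sub>L real. (\<forall>x\<in>V. blinfun_apply g x = f x) \<and> norm g \<le> K"
proof -
  have "\<exists>g. linear g \<and> (\<forall>x\<in>V. g x = f x) \<and> (\<forall>x. g x \<le> K * norm x)"
  proof (rule hahn_banach_sublinear[OF _ _ V f_add f_scale f_le])
    show "K * norm (x + y) \<le> K * norm x + K * norm y" for x y :: 'a
      using mult_left_mono[OF norm_triangle_ineq K, of x y] by (simp add: distrib_left)
  qed auto
  then obtain g where g: "linear g" "\<forall>x\<in>V. g x = f x" "\<And>x. g x \<le> K * norm x" by blast
  \<comment> \<open>Since the dominating function is even, one-sided domination at \<open>x\<close>
    and at \<open>-x\<close> bounds the absolute value.\<close>
  have bound: "norm (g x) \<le> K * norm x" for x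
    using g(3)[of x] g(3)[of "-x"] by (simp add: linear_neg[OF g(1)] abs_le_iff)
  then have "bounded_linear g"
    using g(1) by (intro bounded_linear_intro[of g K])
      (auto simp: linear_add linear_cmul mult.commute)
  then have "blinfun_apply (Blinfun g) = g"
    by (rule bounded_linear_Blinfun_apply)
  with g(2) bound K show ?thesis
    by (metis norm_blinfun_bound)
qed

section \<open>Functionals on a subspace\<close>

lemma norm_on_cong: "(\<And>y. y \<in> Y \<Longrightarrow> f y = g y) \<Longrightarrow> norm_on Y f = norm_on Y g"
  unfolding norm_on_def by (intro SUP_cong) auto

lemma norm_on_least:
  assumes "subspace Y" and "\<And>y. y \<in> Y \<Longrightarrow> norm y \<le> 1 \<Longrightarrow> \<bar>f y\<bar> \<le> K"
  shows "norm_on Y f \<le> K"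
proof -
  have "0 \<in> Y \<inter> cball 0 1"
    using subspace_0[OF assms(1)] by simp
  then show ?thesis
    unfolding norm_on_def using assms(2) by (intro cSUP_least) auto
qed

lemma norm_on_blinfun_le:
  assumes "subspace Y"
  shows "norm_on Y (blinfun_apply f) \<le> norm f"
proof (rule norm_on_least[OF assms])
  fix y :: 'a assume "norm y \<le> 1"
  then show "\<bar>blinfun_apply f y\<bar> \<le> norm f"
    using norm_blinfun[of f y] mult_left_le[of "norm y" "norm f"] by simp
qed

lemma abs_le_norm_on:
  assumes Y: "subspace Y" and f: "f \<in> dual_on Y" and y: "y \<in> Y"
  shows "\<bar>f y\<bar> \<le> norm_on Y f * norm y"
proof (cases "y = 0")
  case True
  have "f (0 *\<^sub>R y) = 0 * f y" using f y unfolding dual_on_def by blast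
  then show ?thesis using True by simp
next
  case False
  obtain K where K: "\<And>x. x \<in> Y \<Longrightarrow> \<bar>f x\<bar> \<le> K * norm x"
    using f unfolding dual_on_def by blast
  \<comment> \<open>The real supremum in \<open>norm_on\<close> is informative only once boundedness
    is known. The absolute value is taken since \<open>K\<close> may be negative, as can happen when
    Y = {0}.\<close>
  have "\<bar>f x\<bar> \<le> \<bar>K\<bar>" if "x \<in> Y" "norm x \<le> 1" for x
  proof -
    have "K * norm x \<le> \<bar>K\<bar> * norm x" by (intro mult_right_mono) auto
    also have "\<dots> \<le> \<bar>K\<bar> * 1" using that by (intro mult_left_mono) auto
    finally show ?thesis using K[OF that(1)] by simp
  qed
  then have bdd: "bdd_above ((\<lambda>x. \<bar>f x\<bar>) ` (Y \<inter> cball 0 1))"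
    by (intro bdd_aboveI[of _ "\<bar>K\<bar>"]) auto
  let ?u = "(1 / norm y) *\<^sub>R y"
  have "?u \<in> Y \<inter> cball 0 1"
    using y False subspace_scale[OF Y] by simp
  from cSUP_upper[OF this bdd] have "\<bar>f ?u\<bar> \<le> norm_on Y f"
    by (simp add: norm_on_def)
  moreover have "f ?u = (1 / norm y) * f y"
    using f y unfolding dual_on_def by blast
  ultimately show ?thesis
    using False by (simp add: abs_mult field_simps)
qed

lemma norm_on_nonneg:
  assumes Y: "subspace Y" and f: "f \<in> dual_on Y"
  shows "0 \<le> norm_on Y f"
proof -
  obtain K where K: "\<And>x. x \<in> Y \<Longrightarrow> \<bar>f x\<bar> \<le> K * norm x"
    using f unfolding dual_on_def by blast
  show ?thesis
  proof (cases "\<exists>y\<in>Y. y \<noteq> 0")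
    case True
    then obtain y where "y \<in> Y" "y \<noteq> 0" by blast
    then have "0 \<le> norm_on Y f * norm y"
      using abs_le_norm_on[OF Y f] by force
    then show ?thesis
      using \<open>y \<noteq> 0\<close> by (simp add: zero_le_mult_iff)
  next
    case False
    then have "Y \<inter> cball 0 1 = {0}"
      using subspace_0[OF Y] by auto
    then show ?thesis by (simp add: norm_on_def)
  qed
qed

lemma restrict_blinfun_in_dual_on:
  assumes "subspace Y"
  shows "restrict (blinfun_apply f) Y \<in> dual_on Y"
proof -
  have "\<forall>y\<in>Y. \<bar>blinfun_apply f y\<bar> \<le> norm f * norm y"
    using norm_blinfun[of f] by simp
  then show ?thesis
    using assms by (auto simp: dual_on_def subspace_add subspace_scale
        blinfun.add_right blinfun.scaleR_right)
qed

lemma norm_on_restrict: "norm_on Y (restrict f Y) = norm_on Y f"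
  by (rule norm_on_cong) simp

text \<open>Norm-preserving extension: Hahn-Banach with \<open>norm_on Y f\<close> as the dominating
  constant.\<close>

lemma dual_on_extension:
  assumes Y: "subspace Y" and f: "f \<in> dual_on Y"
  obtains g :: "'a::real_normed_vector \<Rightarrow>\<^sub>L real"
  where "\<And>y. y \<in> Y \<Longrightarrow> blinfun_apply g y = f y" "norm g \<le> norm_on Y f"
proof -
  have "\<exists>g :: 'a \<Rightarrow>\<^sub>L real. (\<forall>y\<in>Y. blinfun_apply g y = f y) \<and> norm g \<le> norm_on Y f"
  proof (rule hahn_banach_norm[OF Y])
    show "f y \<le> norm_on Y f * norm y" if "y \<in> Y" for y
      using abs_le_norm_on[OF Y f that] by simp
    show "0 \<le> norm_on Y f" by (rule norm_on_nonneg[OF Y f])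
  qed (use f in \<open>auto simp: dual_on_def\<close>)
  with that show thesis by blast
qed

text \<open>The nontrivial inclusion is norm-preserving extension. The identity lets suprema over
  the ball of the dual of \<open>Y\<close> be taken over the ball of the dual of the whole
  space.\<close>

lemma dual_ball_on_eq_restrict:
  assumes Y: "subspace (Y :: 'a::real_normed_vector set)"
  shows "dual_ball_on Y = (\<lambda>f :: 'a \<Rightarrow>\<^sub>L real. restrict (blinfun_apply f) Y) ` cball 0 1"
proof (intro equalityI subsetI)
  fix f assume "f \<in> dual_ball_on Y"
  then have f: "f \<in> dual_on Y" "norm_on Y f \<le> 1"
    by (auto simp: dual_ball_on_def)
  obtain g :: "'a \<Rightarrow>\<^sub>L real" where g: "\<And>y. y \<in> Y \<Longrightarrow> blinfun_apply g y = f y" "norm g \<le> norm_on Y f"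
    using dual_on_extension[OF Y f(1)] by blast
  \<comment> \<open>Agreement on \<open>Y\<close> gives equality of functions only because members
    of \<open>dual_on Y\<close> are extensional.\<close>
  have "f = restrict (blinfun_apply g) Y"
    using f(1) g(1) by (auto simp: dual_on_def extensional_def fun_eq_iff)
  then show "f \<in> (\<lambda>f :: 'a \<Rightarrow>\<^sub>L real. restrict (blinfun_apply f) Y) ` cball 0 1"
    using g(2) f(2) by auto
next
  fix f assume "f \<in> (\<lambda>f :: 'a \<Rightarrow>\<^sub>L real. restrict (blinfun_apply f) Y) ` cball 0 1"
  then obtain g :: "'a \<Rightarrow>\<^sub>L real" where "f = restrict (blinfun_apply g) Y" "norm g \<le> 1" by auto
  then show "f \<in> dual_ball_on Y"
    using norm_on_blinfun_le[OF Y, of g]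
    by (simp add: dual_ball_on_def restrict_blinfun_in_dual_on[OF Y] norm_on_restrict)
qed

text \<open>As \<open>y\<close> lies in \<open>Y\<close>, evaluation at \<open>y\<close> does not
  see the restriction, so both balls yield the same set of values at \<open>y\<close> and hence the
  same supremum.\<close>

lemma restrict_in_w_star_slice_iff:
  assumes Y: "subspace (Y :: 'a::real_normed_vector set)" and y: "y \<in> Y"
    and f: "f \<in> cball 0 1"
  shows "restrict (blinfun_apply f) Y \<in> w_star_slice (\<lambda>f. f) (dual_ball_on Y) y \<alpha> \<longleftrightarrow>
    f \<in> w_star_slice blinfun_apply (cball 0 1) y \<alpha>"
  using y f by (auto simp: w_star_slice_def dual_ball_on_eq_restrict[OF Y] image_image)

lemma norm_on_diff_le_diameter_on:
  assumes Y: "subspace Y" and S: "S \<subseteq> dual_ball_on Y" and f: "f \<in> S" and g: "g \<in> S"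
  shows "norm_on Y (\<lambda>y. f y - g y) \<le> diameter_on Y S"
proof -
  \<comment> \<open>The bound 2 for differences of elements of the unit ball only serves to make the
    supremum in \<open>diameter_on\<close> one over a bounded set.\<close>
  have le2: "norm_on Y (\<lambda>y. f y - g y) \<le> 2" if "f \<in> S" "g \<in> S" for f g
  proof (rule norm_on_least[OF Y])
    fix y assume y: "y \<in> Y" "norm y \<le> 1"
    have "\<bar>h y\<bar> \<le> 1" if "h \<in> S" for h
    proof -
      have h: "h \<in> dual_on Y" "norm_on Y h \<le> 1"
        using that S by (auto simp: dual_ball_on_def)
      show ?thesis
        using abs_le_norm_on[OF Y h(1) y(1)] norm_on_nonneg[OF Y h(1)]
          mult_le_one[OF h(2) norm_ge_zero y(2)] by linarith
    qed
    with \<open>f \<in> S\<close> \<open>g \<in> S\<close> show "\<bar>f y - g y\<bar> \<le> 2"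
      by (smt (verit))
  qed
  then have bdd: "bdd_above ((\<lambda>(f, g). norm_on Y (\<lambda>y. f y - g y)) ` (S \<times> S))"
    by (intro bdd_aboveI[of _ 2]) auto
  have "(f, g) \<in> S \<times> S" using f g by simp
  from cSUP_upper[OF this bdd] show ?thesis
    using f by (auto simp: diameter_on_def)
qed

text \<open>Needed where the diameter serves as an operator norm bound, and where a slice might be
  empty.\<close>

lemma diameter_on_nonneg:
  assumes Y: "subspace Y" and S: "S \<subseteq> dual_ball_on Y"
  shows "0 \<le> diameter_on Y S"
proof (cases "S = {}")
  case True
  then show ?thesis by (simp add: diameter_on_def)
next
  case False
  then obtain f where "f \<in> S" by blast
  have "norm_on Y (\<lambda>y. f y - f y) = (SUP y\<in>Y \<inter> cball 0 1. 0)"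
    by (simp add: norm_on_def)
  also have "\<dots> = 0"
    using subspace_0[OF Y] by (intro cSUP_const) auto
  finally show ?thesis
    using norm_on_diff_le_diameter_on[OF Y S \<open>f \<in> S\<close> \<open>f \<in> S\<close>] by simp
qed

section \<open>Ideals\<close>

text \<open>Since the kernel of \<open>P\<close> is the annihilator of \<open>Y\<close>, the value
  \<open>P f\<close> depends only on the restriction of \<open>f\<close> to \<open>Y\<close>. So
  \<open>f\<close> may be replaced by a norm-preserving extension of that restriction, on which
  \<open>P\<close> is contractive.\<close>

lemma norm_ideal_projection_le_norm_on:
  assumes Y: "subspace Y" and P: "ideal_projection Y P"
  shows "norm (blinfun_apply P f) \<le> norm_on Y (blinfun_apply f)"
proof -
  obtain g where g: "\<And>y. y \<in> Y \<Longrightarrow> blinfun_apply g y = restrict (blinfun_apply f) Y y"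
    "norm g \<le> norm_on Y (restrict (blinfun_apply f) Y)"
    using dual_on_extension[OF Y restrict_blinfun_in_dual_on[OF Y]] by blast
  have "f - g \<in> annihilator Y"
    using g(1) by (simp add: annihilator_def blinfun.diff_left)
  then have "blinfun_apply P (f - g) = 0"
    using P by (auto simp: ideal_projection_def)
  then have "blinfun_apply P f = blinfun_apply P g"
    by (simp add: blinfun.diff_right)
  also have "norm \<dots> \<le> norm g"
    using norm_blinfun[of P g] P by (simp add: ideal_projection_def)
  finally show ?thesis
    using g(2) by (simp add: norm_on_restrict)
qed

text \<open>An idempotent fixes its range, so the previous estimate applies to \<open>f\<close>
  itself. Together with \<open>norm_on_blinfun_le\<close> it makes restriction to \<open>Y\<close>
  isometric on the range.\<close>

lemma norm_le_norm_on_range: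
  assumes Y: "subspace Y" and P: "ideal_projection Y P"
    and f: "f \<in> range (blinfun_apply P)"
  shows "norm f \<le> norm_on Y (blinfun_apply f)"
proof -
  have "blinfun_apply P (blinfun_apply P h) = blinfun_apply P h" for h
    using P unfolding ideal_projection_def by (metis blinfun_apply_blinfun_compose)
  with f have "blinfun_apply P f = f" by auto
  with norm_ideal_projection_le_norm_on[OF Y P, of f] show ?thesis by simp
qed

lemma closure_of_strong_operator_topology_approx:
  assumes f: "f \<in> strong_operator_topology closure_of A" and "0 < \<delta>" and "finite X"
  obtains g where "g \<in> A"
    "\<And>x. x \<in> X \<Longrightarrow> dist (blinfun_apply g x) (blinfun_apply f x) < \<delta>"
proof -
  \<comment> \<open>A basic neighbourhood of \<open>f\<close>: finitely many evaluations are
    confined to balls of radius \<delta>.\<close>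
  let ?T = "{g. \<forall>x\<in>X. blinfun_apply g x \<in> ball (blinfun_apply f x) \<delta>}"
  have "openin strong_operator_topology ?T"
    using strong_operator_topology_basis[OF \<open>finite X\<close>, of "\<lambda>x. ball (blinfun_apply f x) \<delta>" id]
    by simp
  moreover have "f \<in> ?T"
    using \<open>0 < \<delta>\<close> by simp
  ultimately have "\<exists>g. g \<in> A \<and> g \<in> ?T"
    using f[unfolded in_closure_of, THEN conjunct2, rule_format, of ?T] by simp
  then obtain g where "g \<in> A" "g \<in> ?T"
    by (elim exE conjE)
  with that[of g] show thesis
    by (simp add: dist_commute)
qed

lemma strict_ideal_slice_norm_diff_le:
  fixes Y :: "'a::real_normed_vector set"
  assumes Y: "subspace Y" and P: "ideal_projection Y P"
    and dense: "cball 0 1 \<subseteq>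
      strong_operator_topology closure_of (cball 0 1 \<inter> range (blinfun_apply P))"
    and y: "y \<in> Y"
    and f: "f \<in> w_star_slice blinfun_apply (cball 0 1) y \<alpha>"
    and g: "g \<in> w_star_slice blinfun_apply (cball 0 1) y \<alpha>"
  shows "norm (f - g) \<le> diameter_on Y (w_star_slice (\<lambda>f. f) (dual_ball_on Y) y \<alpha>)"
    (is "_ \<le> ?d")
proof -
  define S :: "('a \<Rightarrow>\<^sub>L real) set" where "S = w_star_slice blinfun_apply (cball 0 1) y \<alpha>"
  have approx: "\<exists>h'\<in>S \<inter> range (blinfun_apply P).
      \<bar>blinfun_apply h' x - blinfun_apply h x\<bar> < \<delta>"
    if h: "h \<in> S" and "0 < \<delta>" for h x \<delta>
  proof -
    define c where "c = (SUP c\<in>cball 0 1 :: ('a \<Rightarrow>\<^sub>L real) set. blinfun_apply c y) - \<alpha>"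
    have S: "S = {h \<in> cball 0 1. c < blinfun_apply h y}"
      by (simp add: S_def w_star_slice_def c_def)
    \<comment> \<open>The second term is the margin by which \<open>h\<close> clears the cutoff
      \<open>c\<close>. Approximation within \<eta> at \<open>y\<close> therefore keeps
      \<open>h'\<close> in the slice, while approximation within \<eta> at \<open>x\<close> gives
      the required accuracy.\<close>
    define \<eta> where "\<eta> = min \<delta> (blinfun_apply h y - c)"
    have "0 < \<eta>" using h \<open>0 < \<delta>\<close> by (simp add: \<eta>_def S)
    have "h \<in> strong_operator_topology closure_of (cball 0 1 \<inter> range (blinfun_apply P))"
      using h dense by (auto simp: S)
    then obtain h' where h': "h' \<in> cball 0 1 \<inter> range (blinfun_apply P)"
      and near: "\<And>z. z \<in> {x, y} \<Longrightarrow> dist (blinfun_apply h' z) (blinfun_apply h z) < \<eta>"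
      using closure_of_strong_operator_topology_approx[OF _ \<open>0 < \<eta>\<close>, of h _ "{x, y}"]
      by blast
    have "h' \<in> S"
      using h' near[of y] by (auto simp: S \<eta>_def dist_real_def)
    moreover have "\<bar>blinfun_apply h' x - blinfun_apply h x\<bar> < \<delta>"
      using near[of x] by (auto simp: \<eta>_def dist_real_def)
    ultimately show ?thesis using h' by blast
  qed
  have range_diff: "norm (f' - g') \<le> ?d"
    if "f' \<in> S \<inter> range (blinfun_apply P)" "g' \<in> S \<inter> range (blinfun_apply P)" for f' g'
  proof -
    \<comment> \<open>The range is a linear subspace, so restriction preserves the norm of the
      difference as well.\<close>
    have "f' - g' \<in> range (blinfun_apply P)"
      using that by (auto simp flip: blinfun.diff_right)
    then have "norm (f' - g') \<le> norm_on Y (blinfun_apply (f' - g'))"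
      by (rule norm_le_norm_on_range[OF Y P])
    also have "\<dots> = norm_on Y (\<lambda>z. restrict (blinfun_apply f') Y z - restrict (blinfun_apply g') Y z)"
      by (rule norm_on_cong) (simp add: blinfun.diff_left)
    also have "\<dots> \<le> ?d"
    proof (rule norm_on_diff_le_diameter_on[OF Y])
      have "h \<in> cball 0 1" if "h \<in> S" for h
        using that by (simp add: S_def w_star_slice_def)
      then show "restrict (blinfun_apply f') Y \<in> w_star_slice (\<lambda>f. f) (dual_ball_on Y) y \<alpha>"
        "restrict (blinfun_apply g') Y \<in> w_star_slice (\<lambda>f. f) (dual_ball_on Y) y \<alpha>"
        using that by (simp_all add: restrict_in_w_star_slice_iff[OF Y y] S_def)
    qed (auto simp: w_star_slice_def)
    finally show ?thesis .
  qed
  have "f \<in> S" "g \<in> S" using f g by (simp_all add: S_def)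
  have "0 \<le> ?d"
    by (rule diameter_on_nonneg[OF Y]) (auto simp: w_star_slice_def)
  then show ?thesis
  proof (rule norm_blinfun_bound)
    fix x
    show "norm (blinfun_apply (f - g) x) \<le> ?d * norm x"
    \<comment> \<open>The approximants depend on \<open>x\<close> and \<epsilon>, so the norm is
      estimated at each point separately. \<open>f'\<close> and \<open>g'\<close> contribute an
      error of \<epsilon>/2 each, and the bound on the norm of f' - g' is uniform.\<close>
    proof (rule field_le_epsilon)
      fix \<epsilon> :: real assume "0 < \<epsilon>"
      then have "0 < \<epsilon> / 2" by simp
      obtain f' where f': "f' \<in> S \<inter> range (blinfun_apply P)"
        "\<bar>blinfun_apply f' x - blinfun_apply f x\<bar> < \<epsilon> / 2"
        using approx[OF \<open>f \<in> S\<close> \<open>0 < \<epsilon> / 2\<close>] by blast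
      obtain g' where g': "g' \<in> S \<inter> range (blinfun_apply P)"
        "\<bar>blinfun_apply g' x - blinfun_apply g x\<bar> < \<epsilon> / 2"
        using approx[OF \<open>g \<in> S\<close> \<open>0 < \<epsilon> / 2\<close>] by blast
      have "\<bar>blinfun_apply f' x - blinfun_apply g' x\<bar> \<le> norm (f' - g') * norm x"
        using norm_blinfun[of "f' - g'" x] by (simp add: blinfun.diff_left)
      also have "\<dots> \<le> ?d * norm x"
        by (intro mult_right_mono range_diff f' g') simp
      finally show "norm (blinfun_apply (f - g) x) \<le> ?d * norm x + \<epsilon>"
        using f'(2) g'(2) unfolding blinfun.diff_left real_norm_def by linarith
    qed
  qed
qed

theorem proposition11:
  fixes Y :: "'a::banach set"
  assumes "strict_ideal Y" and "w_star_BDP_on Y"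
  shows "w_star_BDP TYPE('a)"
  unfolding w_star_BDP_def
proof (intro allI impI)
  fix \<epsilon> :: real assume "0 < \<epsilon>"
  obtain P where Y: "subspace Y" and P: "ideal_projection Y P"
    and dense: "cball 0 1 \<subseteq>
      strong_operator_topology closure_of (cball 0 1 \<inter> range (blinfun_apply P))"
    using assms(1) by (auto simp: strict_ideal_def)
  obtain y \<alpha> where y: "y \<in> Y" "norm y = 1" and "0 < \<alpha>"
    and d: "diameter_on Y (w_star_slice (\<lambda>f. f) (dual_ball_on Y) y \<alpha>) < \<epsilon>"
    using assms(2) \<open>0 < \<epsilon>\<close> unfolding w_star_BDP_on_def by blast
  \<comment> \<open>The same \<open>y\<close> and \<alpha> serve for the whole space, as
    \<open>y\<close> has norm 1 there too.\<close>
  have "diameter (w_star_slice blinfun_apply (cball 0 1 :: ('a \<Rightarrow>\<^sub>L real) set) y \<alpha>)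
      \<le> diameter_on Y (w_star_slice (\<lambda>f. f) (dual_ball_on Y) y \<alpha>)"
  proof (rule diameter_le)
    have "w_star_slice (\<lambda>f. f) (dual_ball_on Y) y \<alpha> \<subseteq> dual_ball_on Y"
      by (auto simp: w_star_slice_def)
    then show "w_star_slice blinfun_apply (cball 0 1 :: ('a \<Rightarrow>\<^sub>L real) set) y \<alpha> \<noteq> {} \<or>
        0 \<le> diameter_on Y (w_star_slice (\<lambda>f. f) (dual_ball_on Y) y \<alpha>)"
      using diameter_on_nonneg[OF Y] by blast
  qed (rule strict_ideal_slice_norm_diff_le[OF Y P dense y(1)])
  with d y \<open>0 < \<alpha>\<close> show "\<exists>x::'a. \<exists>\<alpha>>0. norm x = 1 \<and>
      diameter (w_star_slice blinfun_apply (cball 0 1 :: ('a \<Rightarrow>\<^sub>L real) set) x \<alpha>) < \<epsilon>"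
    using order_le_less_trans by blast
qed

end
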